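(* Let $x, y$ be two distinct positive rational numbers with $xy=3$, and let $a=\frac{x+y}{2}$ and $h=\frac{2}{1/x+1/y}$ be their arithmetic and harmonic means respectively. Then $ah=3$ and $h<\sqrt{3}<a$. Moreover, $3$ must be a factor of the numerator of $h$, where $h$ is written as a fraction in lowest terms.
   Context: The numerator of a positive rational number $h$ means the positive integer $p$ in the unique expression $h=p/q$ with $p,q$ positive coprime integers. *)

theory Defs
  imports Complex_Main
begin

end

theory Submission
  imports Defs "HOL-Computational_Algebra.Primes"
begin

text \<open>
  Since \<open>h = 2 x y / (x + y)\<close>, the means satisfy \<open>a h = x y = 3\<close>. The numbers \<open>x\<close> and \<open>y\<close> are
  distinct, so \<open>a\<^sup>2 - 3 = ((x - y) / 2)\<^sup>2\<close> is positive; hence \<open>\<surd>3 < a\<close>, and \<open>h = 3 / a < \<surd>3\<close>.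

  For the numerator, write \<open>x = m / n\<close> in lowest terms, so that \<open>y = 3 n / m\<close> and
  \<open>h = 6 m n / (m\<^sup>2 + 3 n\<^sup>2)\<close>. The fraction on the right is divisible by 3 in the 3-adic sense: the
  denominator is prime to 3 unless \<open>m\<close> is divisible by 3, and then the denominator contains a
  single factor 3 against at least two in the numerator. This is \<open>prime_dvd_mean_numerator\<close>, stated
  for an arbitrary prime in place of 3.
\<close>

text \<open>
  For \<open>l = 3\<close> and \<open>r = 2 q\<close> the equation is the cleared form of
  \<open>p / q = 6 m n / (m\<^sup>2 + 3 n\<^sup>2)\<close>. If \<open>l\<close> does not divide \<open>m\<close>, reducing modulo \<open>l\<close> leaves
  \<open>p m\<^sup>2\<close>; if \<open>m = l k\<close>, cancelling one factor \<open>l\<close> and then reducing leaves \<open>p n\<^sup>2\<close>, where \<open>n\<close> is now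
  prime to \<open>l\<close>.
\<close>

lemma prime_dvd_mean_numerator:
  fixes l m n p r :: int
  assumes l: "prime l" and mn: "coprime m n"
    and eq: "p * (m\<^sup>2 + l * n\<^sup>2) = l * (m * n * r)"
  shows "l dvd p"
proof (cases "l dvd m")
  case False
  have "p * m\<^sup>2 = l * (m * n * r - p * n\<^sup>2)"
    using eq by (simp add: algebra_simps)
  then have "l dvd p * m\<^sup>2" by simp
  then show ?thesis
    using False l by (auto simp: prime_dvd_mult_iff prime_dvd_power_iff)
next
  case True
  then obtain k where k: "m = l * k" ..
  have "\<not> l dvd n"
    using True l mn by (meson coprime_common_divisor not_prime_unit)
  have "l * (p * n\<^sup>2) = l * (l * (k * n * r - p * k\<^sup>2))"
    using eq by (simp add: k power2_eq_square algebra_simps)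
  then have "p * n\<^sup>2 = l * (k * n * r - p * k\<^sup>2)"
    using l by (metis mult_cancel_left not_prime_0)
  then have "l dvd p * n\<^sup>2" by simp
  then show ?thesis
    using \<open>\<not> l dvd n\<close> l by (auto simp: prime_dvd_mult_iff prime_dvd_power_iff)
qed

theorem theorem1:
  fixes x y a h :: rat
  assumes "x > 0" and "y > 0" and "x \<noteq> y"
    and "x * y = 3"
    and "a = (x + y) / 2"
    and "h = 2 / (1 / x + 1 / y)"
  shows "a * h = 3 \<and> real_of_rat h < sqrt 3 \<and> sqrt 3 < real_of_rat a
    \<and> 3 dvd fst (quotient_of h)"
proof -
  have "x + y > 0" using assms(1,2) by simp
  have h: "h * (x + y) = 6"
  proof -
    have "1 / x + 1 / y = (x + y) / (x * y)"
      using assms(1,2) by (simp add: field_simps)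
    then have "h = 2 / ((x + y) / 3)" by (simp only: assms(4,6))
    then show ?thesis using \<open>x + y > 0\<close> by (simp add: divide_simps)
  qed
  have "x + y = 2 * a" using assms(5) by simp
  then have ah: "a * h = 3" using h by (simp add: mult.commute)
  have "a > 0" using \<open>x + y > 0\<close> assms(5) by simp

  have "a\<^sup>2 - 3 = ((x - y) / 2)\<^sup>2"
    unfolding assms(5) assms(4)[symmetric] by (simp add: power2_eq_square field_simps)
  moreover have "((x - y) / 2)\<^sup>2 > 0" using assms(3) by simp
  ultimately have "3 < a\<^sup>2" by linarith
  then have "real_of_rat 3 < real_of_rat (a\<^sup>2)" by (simp only: of_rat_less)
  then have "3 < (real_of_rat a)\<^sup>2" by (simp add: of_rat_power)
  then have a_gt: "sqrt 3 < real_of_rat a"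
    using \<open>a > 0\<close> by (intro real_less_lsqrt) auto
  have "real_of_rat a * real_of_rat h = 3"
    using arg_cong[OF ah, of real_of_rat] by (simp add: of_rat_mult)
  then have "real_of_rat h = sqrt 3 * sqrt 3 / real_of_rat a"
    using \<open>a > 0\<close> by (simp add: field_simps)
  also have "\<dots> < sqrt 3"
    using a_gt \<open>a > 0\<close> by (simp add: divide_less_eq del: real_sqrt_mult_self)
  finally have h_lt: "real_of_rat h < sqrt 3" .

  obtain m n where x: "quotient_of x = (m, n)" by fastforce
  obtain p q where hq: "quotient_of h = (p, q)" by fastforce
  have n: "n > 0" and q: "q > 0" and mn: "coprime m n"
    using x hq by (auto intro: quotient_of_denom_pos quotient_of_coprime)
  have xmn: "x = of_int m / of_int n" and hpq: "h = of_int p / of_int q"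
    using x hq by (auto intro: quotient_of_div)
  have "m \<noteq> 0" using assms(1) xmn by auto
  have "y = 3 * of_int n / of_int m"
    using assms(4) n \<open>m \<noteq> 0\<close> by (simp add: xmn field_simps)
  with h have "rat_of_int p * (of_int m ^ 2 + 3 * of_int n ^ 2) = 3 * (of_int m * of_int n * (2 * of_int q))"
    using n q \<open>m \<noteq> 0\<close> by (simp add: xmn hpq field_simps power2_eq_square)
  then have "rat_of_int (p * (m\<^sup>2 + 3 * n\<^sup>2)) = rat_of_int (3 * (m * n * (2 * q)))"
    by simp
  then have "p * (m\<^sup>2 + 3 * n\<^sup>2) = 3 * (m * n * (2 * q))"
    by (simp only: of_int_eq_iff)
  then have "3 dvd p"
    using mn by (intro prime_dvd_mean_numerator[of 3 m n p "2 * q"]) auto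
  then show ?thesis using ah h_lt a_gt hq by simp
qed

end
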